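(* Let $\ell>0$, $0\le\mu\le1$, $0<t_e<1$, $t_d=1-t_e$, and set $\ell_o=\mu\ell$ and $\ell_c=(1-\mu)\ell$. Let $$\epsilon = t_e\left(\gamma_2 P r^{-\alpha}|h|^2+\tfrac32\gamma_4P^2r^{-2\alpha}|h|^4\right),\qquad \epsilon_o=t_d\left(2^{\frac{\ell_o}{t_dB}}-1\right)\frac{\sigma^2r^{\alpha}}{|g|^2},\qquad \epsilon_c=\xi\psi^3\ell_c^3 .$$ Then the success probability $P_s(\mu,t_e)=\mathbb{P}(\epsilon>\epsilon_o+\epsilon_c)$, i.e. the probability of successfully offloading $\ell_o$ bits and locally computing $\ell_c$ bits, is $$P_s(\mu,t_e)=\int_0^\infty \exp\left(\frac{r^{\alpha}\gamma_2}{3\gamma_4P}\left(1-\sqrt{1+\frac{6\gamma_4}{t_e\gamma_2^2}\left(\frac{\phi_o}{x}+\phi_c\right)}\right)\right)\exp(-x)\,dx,$$ where $\phi_o=\left(2^{\frac{\ell_o}{t_dB}}-1\right)t_d\sigma^2r^{\alpha}$ and $\phi_c=\ell_c^3\xi\psi^3$.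
   Context: $h$ and $g$ are independent circularly symmetric complex Gaussian random variables $\mathcal{CN}(0,1)$ (downlink and uplink channel coefficients), so that $|h|^2$ and $|g|^2$ are independent exponential random variables with mean $1$. The constants $P$ (transmit power), $r$ (distance), $B$ (bandwidth), $\sigma^2$ (noise variance), $\xi$ (CPU capacitance coefficient), $\psi$ (CPU cycles per bit), $\gamma_2,\gamma_4$ (rectifier constants) are all positive reals, and $\alpha>2$ is the path-loss exponent. $\epsilon$ is the energy harvested during time $t_e$, $\epsilon_o$ is the energy required to offload $\ell_o$ bits during time $t_d$, and $\epsilon_c$ is the energy required to compute $\ell_c$ bits locally. *)

theory Defs
  imports "HOL-Probability.Probability"
begin

text \<open>
  The circularly symmetric complex Gaussian law with mean zero and variance \<open>v\<close>: real and
  imaginary part are independent, and each carries half of the variance. Note that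
  \<^const>\<open>normal_density\<close> takes the standard deviation as its second argument.
\<close>

definition (in prob_space) circ_sym_complex_gaussian :: "real \<Rightarrow> ('a \<Rightarrow> complex) \<Rightarrow> bool" where
  "circ_sym_complex_gaussian v Z \<longleftrightarrow>
     random_variable borel Z \<and>
     indep_var borel (\<lambda>\<omega>. Re (Z \<omega>)) borel (\<lambda>\<omega>. Im (Z \<omega>)) \<and>
     distributed M lborel (\<lambda>\<omega>. Re (Z \<omega>)) (\<lambda>x. ennreal (normal_density 0 (sqrt (v / 2)) x)) \<and>
     distributed M lborel (\<lambda>\<omega>. Im (Z \<omega>)) (\<lambda>x. ennreal (normal_density 0 (sqrt (v / 2)) x))"

text \<open>
  Energy harvested during time \<open>t\<close> from a signal of power \<open>P\<close> sent over distance \<open>r\<close> through the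
  channel coefficient \<open>z\<close>.
\<close>

definition harvested_energy ::
    "real \<Rightarrow> real \<Rightarrow> real \<Rightarrow> real \<Rightarrow> real \<Rightarrow> real \<Rightarrow> complex \<Rightarrow> real" where
  "harvested_energy \<gamma>2 \<gamma>4 P r \<alpha> t z =
     t * (\<gamma>2 * P * r powr (- \<alpha>) * cmod z ^ 2
          + 3 / 2 * \<gamma>4 * P ^ 2 * r powr (- 2 * \<alpha>) * cmod z ^ 4)"

text \<open>
  Energy required to offload \<open>l\<close> bits during time \<open>t\<close> over bandwidth \<open>B\<close> with noise variance
  \<open>\<sigma>\<^sup>2\<close>. At \<open>z = 0\<close>, where the true value is infinite (or undefined, for \<open>l = 0\<close>), it takes the
  value \<open>0\<close> because \<open>x / 0 = 0\<close>; for a Gaussian coefficient this is a null event.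
\<close>

definition offload_energy ::
    "real \<Rightarrow> real \<Rightarrow> real \<Rightarrow> real \<Rightarrow> real \<Rightarrow> real \<Rightarrow> complex \<Rightarrow> real" where
  "offload_energy B \<sigma> r \<alpha> t l z =
     t * (2 powr (l / (t * B)) - 1) * (\<sigma> ^ 2 * r powr \<alpha> / cmod z ^ 2)"

definition local_energy :: "real \<Rightarrow> real \<Rightarrow> real \<Rightarrow> real" where
  "local_energy \<xi> \<psi> l = \<xi> * \<psi> ^ 3 * l ^ 3"

end

theory Submission
  imports Defs
begin

text \<open>
  The squared modulus of a standard circularly symmetric complex Gaussian variable is
  exponentially distributed with mean \<open>1\<close>. Given \<open>\<bar>g\<bar>\<^sup>2 = x\<close>, the success event is a quadratic
  inequality for \<open>\<bar>h\<bar>\<^sup>2\<close>, that is, \<open>\<bar>h\<bar>\<^sup>2\<close> exceeds the nonnegative root of the quadratic. By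
  independence, integrating the exponential tail at that root against the law of \<open>\<bar>g\<bar>\<^sup>2\<close> gives the
  formula.
\<close>

section \<open>Planar Gaussian mass and the law of the squared modulus\<close>

lemma nn_integral_exp_Ioi:
  fixes a :: real
  shows "(\<integral>\<^sup>+x. ennreal (exp (- x)) * indicator {a<..} x \<partial>lborel) = ennreal (exp (- a))"
proof -
  \<comment> \<open>The endpoint \<open>a\<close> is a null set; closing the half-line gives the
    form in which the fundamental theorem of calculus applies.\<close>
  have "(\<integral>\<^sup>+x. ennreal (exp (- x)) * indicator {a<..} x \<partial>lborel)
      = (\<integral>\<^sup>+x. ennreal (exp (- x)) * indicator {a..} x \<partial>lborel)"
    using AE_lborel_singleton[of a]
    by (intro nn_integral_cong_AE) (auto elim!: eventually_mono split: split_indicator)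
  also have "\<dots> = ennreal (0 - (- exp (- a)))"
  proof (rule nn_integral_FTC_atLeast)
    show "((\<lambda>x::real. - exp (- x)) \<longlongrightarrow> 0) at_top"
      by real_asymp
  qed (auto intro!: derivative_eq_intros)
  finally show ?thesis by simp
qed

text \<open>Evaluates the outer integral left after Tonelli: the factor \<open>u - a\<close> is the
  area of an annulus divided by pi. Integration by parts yields the antiderivative.\<close>

lemma nn_integral_shifted_linear_exp:
  fixes a :: real
  shows "(\<integral>\<^sup>+u. ennreal ((u - a) * exp (- u)) * indicator {a..} u \<partial>lborel) = ennreal (exp (- a))"
proof -
  have "(\<integral>\<^sup>+u. ennreal ((u - a) * exp (- u)) * indicator {a..} u \<partial>lborel)
      = ennreal (0 - (- (a - a + 1) * exp (- a)))"
  proof (rule nn_integral_FTC_atLeast[where F = "\<lambda>u. - (u - a + 1) * exp (- u)"])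
    show "((\<lambda>u. - (u - a + 1) * exp (- u)) \<longlongrightarrow> 0) at_top"
      by real_asymp
  qed (auto intro!: derivative_eq_intros simp: algebra_simps)
  then show ?thesis by simp
qed

text \<open>The norm on \<open>real \<times> real\<close> is Euclidean, and with the inner bound
  strict and the outer one not, the annulus is exactly a difference of two closed discs.\<close>

lemma emeasure_annulus:
  fixes a u :: real
  assumes "0 \<le> a" "a \<le> u"
  shows "emeasure lborel {p :: real \<times> real. a < (norm p)\<^sup>2 \<and> (norm p)\<^sup>2 \<le> u} = ennreal (pi * (u - a))"
proof -
  have le_iff: "(norm p)\<^sup>2 \<le> b \<longleftrightarrow> norm p \<le> sqrt b" if "0 \<le> b" for b and p :: "real \<times> real"
    using that by (metis norm_ge_zero real_le_rsqrt real_sqrt_le_iff real_sqrt_pow2 real_sqrt_unique power_mono)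
  have eq: "{p :: real \<times> real. a < (norm p)\<^sup>2 \<and> (norm p)\<^sup>2 \<le> u} = cball 0 (sqrt u) - cball 0 (sqrt a)"
    using assms le_iff[of a] le_iff[of u] by (auto simp: not_le[symmetric])
  have vol: "emeasure lborel (cball (0 :: real \<times> real) (sqrt b)) = ennreal (pi * b)" if "0 \<le> b" for b
    using that by (simp add: emeasure_cball unit_ball_vol_2)
  have "emeasure lborel (cball 0 (sqrt u) - cball 0 (sqrt a) :: (real \<times> real) set)
      = ennreal (pi * u) - ennreal (pi * a)"
    using assms by (subst emeasure_Diff) (auto simp: vol intro!: subset_cball)
  also have "\<dots> = ennreal (pi * (u - a))"
    using assms by (simp add: ennreal_minus right_diff_distrib)
  finally show ?thesis by (simp add: eq)
qed

text \<open>
  The layer-cake formula \<open>exp (- s) = (\<integral>u>s. exp (- u))\<close> and Tonelli reduce the Gaussian integral to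
  areas of annuli, so no change to polar coordinates is needed.
\<close>

lemma nn_integral_gaussian_outside_disc:
  fixes a :: real
  assumes "0 \<le> a"
  shows "(\<integral>\<^sup>+p. ennreal (exp (- (norm p)\<^sup>2) / pi) * indicator {p. a < (norm p)\<^sup>2} p
            \<partial>(lborel :: (real \<times> real) measure)) = ennreal (exp (- a))"
proof -
  let ?L = "lborel :: (real \<times> real) measure"
  \<comment> \<open>Integrated over \<open>u\<close>, this kernel gives the Gaussian weight outside
    the disc; integrated over \<open>p\<close>, an annulus area times
    \<open>exp (- u) / pi\<close>.\<close>
  let ?k = "\<lambda>p u. ennreal (exp (- u) / pi) * indicator {(p :: real \<times> real, u). a < (norm p)\<^sup>2 \<and> (norm p)\<^sup>2 \<le> u} (p, u)"
  have [measurable]: "{(p :: real \<times> real, u :: real). a < (norm p)\<^sup>2 \<and> (norm p)\<^sup>2 \<le> u}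
      \<in> sets (?L \<Otimes>\<^sub>M lborel)"
  proof -
    have "{x \<in> space (?L \<Otimes>\<^sub>M lborel). a < (norm (fst x))\<^sup>2 \<and> (norm (fst x))\<^sup>2 \<le> snd x}
        \<in> sets (?L \<Otimes>\<^sub>M (lborel :: real measure))"
      by measurable
    also have "{x \<in> space (?L \<Otimes>\<^sub>M lborel). a < (norm (fst x))\<^sup>2 \<and> (norm (fst x))\<^sup>2 \<le> snd x}
        = {(p, u). a < (norm p)\<^sup>2 \<and> (norm p)\<^sup>2 \<le> u}"
      by (auto simp: space_pair_measure)
    finally show ?thesis .
  qed
  have "(\<integral>\<^sup>+p. ennreal (exp (- (norm p)\<^sup>2) / pi) * indicator {p. a < (norm p)\<^sup>2} p \<partial>?L)
      = (\<integral>\<^sup>+p. \<integral>\<^sup>+u. ?k p u \<partial>lborel \<partial>?L)"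
  proof (rule nn_integral_cong)
    fix p :: "real \<times> real"
    \<comment> \<open>The kernel includes the point u = \<open>(norm p)\<^sup>2\<close>, the tail
      integral excludes it; a single point is null.\<close>
    have "(\<integral>\<^sup>+u. ?k p u \<partial>lborel)
        = (\<integral>\<^sup>+u. (ennreal (1 / pi) * indicator {p. a < (norm p)\<^sup>2} p)
                 * (ennreal (exp (- u)) * indicator {(norm p)\<^sup>2<..} u) \<partial>lborel)"
      using AE_lborel_singleton[of "(norm p)\<^sup>2"]
      by (intro nn_integral_cong_AE)
         (auto elim!: eventually_mono split: split_indicator simp: ennreal_mult[symmetric])
    also have "\<dots> = (ennreal (1 / pi) * indicator {p. a < (norm p)\<^sup>2} p) * ennreal (exp (- (norm p)\<^sup>2))"
      by (subst nn_integral_cmult) (auto simp: nn_integral_exp_Ioi)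
    finally show "ennreal (exp (- (norm p)\<^sup>2) / pi) * indicator {p. a < (norm p)\<^sup>2} p
        = (\<integral>\<^sup>+u. ?k p u \<partial>lborel)"
      by (auto split: split_indicator simp: ennreal_mult[symmetric])
  qed
  also have "\<dots> = (\<integral>\<^sup>+u. \<integral>\<^sup>+p. ?k p u \<partial>?L \<partial>lborel)"
    by (rule lborel_pair.Fubini'[symmetric]) measurable
  also have "\<dots> = (\<integral>\<^sup>+u. ennreal ((u - a) * exp (- u)) * indicator {a..} u \<partial>lborel)"
  proof (rule nn_integral_cong)
    fix u :: real
    have "(\<integral>\<^sup>+p. ?k p u \<partial>?L)
        = (\<integral>\<^sup>+p. ennreal (exp (- u) / pi)
                 * indicator {p. a < (norm p)\<^sup>2 \<and> (norm p)\<^sup>2 \<le> u} p \<partial>?L)"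
      by (intro nn_integral_cong) (auto split: split_indicator)
    also have "\<dots> = ennreal (exp (- u) / pi)
        * emeasure ?L {p. a < (norm p)\<^sup>2 \<and> (norm p)\<^sup>2 \<le> u}"
      by (rule nn_integral_cmult_indicator) measurable
    also have "\<dots> = ennreal ((u - a) * exp (- u)) * indicator {a..} u"
    proof (cases "a \<le> u")
      case True
      then show ?thesis
        using assms by (simp add: emeasure_annulus ennreal_mult[symmetric] mult.commute)
    next
      case False
      then have "{p :: real \<times> real. a < (norm p)\<^sup>2 \<and> (norm p)\<^sup>2 \<le> u} = {}"
        by auto
      with False show ?thesis by (simp only:) simp
    qed
    finally show "(\<integral>\<^sup>+p. ?k p u \<partial>?L) = ennreal ((u - a) * exp (- u)) * indicator {a..} u" .
  qed
  finally show ?thesis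
    by (simp add: nn_integral_shifted_linear_exp)
qed

text \<open>By independence the real and imaginary parts have joint density exp(-|z|^2)/pi. Its mass
  outside the disc |z|^2 \<le> a is exp(-a), and this tail characterises the exponential
  law.\<close>

lemma (in prob_space) circ_sym_complex_gaussian_cmod2_exponential:
  assumes "circ_sym_complex_gaussian 1 Z"
  shows "distributed M lborel (\<lambda>\<omega>. (cmod (Z \<omega>))\<^sup>2) (exponential_density 1)"
proof -
  let ?n = "\<lambda>x. ennreal (normal_density 0 (sqrt (1 / 2)) x)"
  let ?R = "\<lambda>\<omega>. Re (Z \<omega>)" and ?I = "\<lambda>\<omega>. Im (Z \<omega>)"
  have Z[measurable]: "Z \<in> borel_measurable M"
    and indep: "indep_var borel ?R borel ?I"
    and R: "distributed M lborel ?R ?n" and I: "distributed M lborel ?I ?n"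
    using assms by (auto simp: circ_sym_complex_gaussian_def)
  \<comment> \<open>Composing with \<open>id\<close> only moves the target from \<open>borel\<close>
    to \<open>lborel\<close>, to match the joint density rule.\<close>
  have "indep_var lborel (id \<circ> ?R) lborel (id \<circ> ?I)"
    by (rule indep_var_compose[OF indep]) simp_all
  then have joint: "distributed M (lborel \<Otimes>\<^sub>M lborel) (\<lambda>\<omega>. (?R \<omega>, ?I \<omega>)) (\<lambda>(x, y). ?n x * ?n y)"
    by (intro distributed_joint_indep R I lborel.sigma_finite_measure_axioms) (simp add: o_def)
  have dens: "(case p of (x, y) \<Rightarrow> ?n x * ?n y) = ennreal (exp (- (norm p)\<^sup>2) / pi)" for p
  proof -
    obtain x y where p: "p = (x, y)" by (cases p)
    have sq: "(norm (x, y))\<^sup>2 = x\<^sup>2 + y\<^sup>2"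
      by (simp add: norm_prod_def)
    \<comment> \<open>With variance 1/2, twice the variance is 1, so the exponent has no factor and
      the normalisation is the square root of pi.\<close>
    have n: "normal_density 0 (sqrt (1 / 2)) x = exp (- x\<^sup>2) / sqrt pi" for x
      by (simp add: normal_density_def power_divide)
    show ?thesis
      by (simp add: p sq n ennreal_mult[symmetric] exp_add[symmetric])
  qed
  have "\<P>(\<omega> in M. (cmod (Z \<omega>))\<^sup>2 \<le> a) = 1 - exp (- a * 1)" if "0 \<le> a" for a
  proof -
    have "emeasure M {\<omega> \<in> space M. a < (cmod (Z \<omega>))\<^sup>2}
        = emeasure M ((\<lambda>\<omega>. (?R \<omega>, ?I \<omega>)) -` {p. a < (norm p)\<^sup>2} \<inter> space M)"
      by (intro arg_cong[where f = "emeasure M"]) (auto simp: norm_prod_def cmod_def)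
    also have "\<dots> = ennreal (exp (- a))"
    proof (subst distributed_emeasure[OF joint])
      show "{p. a < (norm p)\<^sup>2} \<in> sets ((lborel :: real measure) \<Otimes>\<^sub>M (lborel :: real measure))"
        unfolding lborel_prod by measurable
    qed (use nn_integral_gaussian_outside_disc[OF that] in \<open>simp add: dens lborel_prod\<close>)
    finally have "\<P>(\<omega> in M. a < (cmod (Z \<omega>))\<^sup>2) = exp (- a)"
      by (simp add: measure_def)
    moreover have "\<P>(\<omega> in M. \<not> a < (cmod (Z \<omega>))\<^sup>2) = 1 - \<P>(\<omega> in M. a < (cmod (Z \<omega>))\<^sup>2)"
      by (rule prob_neg) measurable
    ultimately show ?thesis by (simp add: not_less)
  qed
  then show ?thesis
    by (simp add: exponential_distributed_iff)
qed

section \<open>Random thresholds and the quadratic inequality\<close>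

text \<open>Given Y = y, the event is an exponential tail beyond \<open>T y\<close>, of probability
  \<open>exp (- T y)\<close> as long as \<open>T y\<close> is nonnegative; Tonelli averages this
  against \<open>f\<close>.\<close>

lemma (in prob_space) prob_exponential_exceeds_indep:
  fixes X Y :: "'a \<Rightarrow> real" and T f :: "real \<Rightarrow> real"
  assumes X: "distributed M lborel X (exponential_density 1)"
    and Y: "distributed M lborel Y f"
    and indep: "indep_var borel X borel Y"
    and [measurable]: "T \<in> borel_measurable borel" "f \<in> borel_measurable borel"
    and f: "\<And>y. 0 \<le> f y" and T: "AE y in lborel. f y \<noteq> 0 \<longrightarrow> 0 \<le> T y"
  shows "\<P>(\<omega> in M. T (Y \<omega>) < X \<omega>) = (LINT y|lborel. f y * exp (- T y))"
proof -
  let ?e = "\<lambda>x. ennreal (exponential_density 1 x)"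
  let ?S = "{(x, y). T y < x}"
  have [measurable]: "?S \<in> sets (lborel \<Otimes>\<^sub>M lborel)"
  proof -
    have "{p \<in> space (lborel \<Otimes>\<^sub>M lborel). T (snd p) < fst p} \<in> sets (lborel \<Otimes>\<^sub>M lborel)"
      by measurable
    also have "{p \<in> space (lborel \<Otimes>\<^sub>M lborel). T (snd p) < fst p} = ?S"
      by (auto simp: space_pair_measure)
    finally show ?thesis .
  qed
  have "indep_var lborel (id \<circ> X) lborel (id \<circ> Y)"
    by (rule indep_var_compose[OF indep]) simp_all
  then have joint: "distributed M (lborel \<Otimes>\<^sub>M lborel) (\<lambda>\<omega>. (X \<omega>, Y \<omega>)) (\<lambda>(x, y). ?e x * ennreal (f y))"
    by (intro distributed_joint_indep X Y lborel.sigma_finite_measure_axioms) (simp add: o_def)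
  have "emeasure M {\<omega> \<in> space M. T (Y \<omega>) < X \<omega>}
      = emeasure M ((\<lambda>\<omega>. (X \<omega>, Y \<omega>)) -` ?S \<inter> space M)"
    by (intro arg_cong[where f = "emeasure M"]) auto
  also have "\<dots> = (\<integral>\<^sup>+p. (case p of (x, y) \<Rightarrow> ?e x * ennreal (f y)) * indicator ?S p
      \<partial>(lborel \<Otimes>\<^sub>M lborel))"
    by (rule distributed_emeasure[OF joint]) measurable
  also have "\<dots> = (\<integral>\<^sup>+y. \<integral>\<^sup>+x. ?e x * ennreal (f y) * indicator ?S (x, y) \<partial>lborel \<partial>lborel)"
    by (subst lborel_pair.nn_integral_snd[symmetric]) (simp_all add: case_prod_beta)
  also have "\<dots> = (\<integral>\<^sup>+y. ennreal (f y * exp (- T y)) \<partial>lborel)"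
  proof (rule nn_integral_cong_AE, use T in eventually_elim)
    fix y assume T: "f y \<noteq> 0 \<longrightarrow> 0 \<le> T y"
    \<comment> \<open>If \<open>f y\<close> is nonzero, every x beyond \<open>T y\<close> is
      positive, where the density is \<open>exp (- x)\<close>; if \<open>f y\<close> is zero, both
      integrands vanish.\<close>
    have "(\<integral>\<^sup>+x. ?e x * ennreal (f y) * indicator ?S (x, y) \<partial>lborel)
        = (\<integral>\<^sup>+x. ennreal (f y) * (ennreal (exp (- x)) * indicator {T y<..} x) \<partial>lborel)"
      using T by (intro nn_integral_cong)
        (auto split: split_indicator simp: exponential_density_def mult.commute)
    also have "\<dots> = ennreal (f y) * ennreal (exp (- T y))"
      by (subst nn_integral_cmult) (auto simp: nn_integral_exp_Ioi)
    finally show "(\<integral>\<^sup>+x. ?e x * ennreal (f y) * indicator ?S (x, y) \<partial>lborel)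
        = ennreal (f y * exp (- T y))"
      by (simp add: ennreal_mult f)
  qed
  finally show ?thesis
    by (subst integral_eq_nn_integral) (simp_all add: measure_def f)
qed

text \<open>For nonnegative w the quadratic increases strictly, so it exceeds q exactly beyond its
  nonnegative root. The root is written with \<open>a\<close> pulled out of the discriminant, the
  shape needed for the exponent.\<close>

lemma quadratic_gt_iff:
  fixes a b w q :: real
  assumes "0 < a" "0 < b" "0 \<le> w" "0 \<le> q"
  shows "q < a * w + b * w\<^sup>2 \<longleftrightarrow> a / (2 * b) * (sqrt (1 + 4 * b * q / a\<^sup>2) - 1) < w"
proof -
  have "a / (2 * b) * (sqrt (1 + 4 * b * q / a\<^sup>2) - 1) < w
      \<longleftrightarrow> sqrt (1 + 4 * b * q / a\<^sup>2) < 1 + 2 * b * w / a"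
    using assms by (simp add: field_simps)
  also have "\<dots> \<longleftrightarrow> 1 + 4 * b * q / a\<^sup>2 < (1 + 2 * b * w / a)\<^sup>2"
    using assms by (subst real_sqrt_less_iff[symmetric]) simp
  also have "\<dots> \<longleftrightarrow> q < a * w + b * w\<^sup>2"
  proof -
    \<comment> \<open>Completing the square: the gap between the squared sides is a positive
      multiple of the excess of the quadratic over q.\<close>
    have "(1 + 2 * b * w / a)\<^sup>2 - (1 + 4 * b * q / a\<^sup>2) = 4 * b / a\<^sup>2 * (a * w + b * w\<^sup>2 - q)"
      using assms by (simp add: field_simps power2_eq_square)
    moreover have "0 < 4 * b / a\<^sup>2"
      using assms by simp
    ultimately show ?thesis
      by (metis diff_gt_0_iff_gt zero_less_mult_pos mult_pos_pos)
  qed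
  finally show ?thesis ..
qed

section \<open>The success probability\<close>

theorem theorem1:
  fixes M :: "'a measure" and h g :: "'a \<Rightarrow> complex"
    and P r B \<sigma> \<xi> \<psi> \<gamma>2 \<gamma>4 \<alpha> l \<mu> t_e t_d l_o l_c \<epsilon>_c \<phi>_o \<phi>_c :: real
    and \<epsilon> \<epsilon>_o :: "'a \<Rightarrow> real"
  assumes "prob_space M"
    and "prob_space.circ_sym_complex_gaussian M 1 h"
    and "prob_space.circ_sym_complex_gaussian M 1 g"
    and "prob_space.indep_var M borel h borel g"
    and "P > 0" "r > 0" "B > 0" "\<sigma> > 0" "\<xi> > 0" "\<psi> > 0" "\<gamma>2 > 0" "\<gamma>4 > 0" "\<alpha> > 2"
    and "l > 0" "0 \<le> \<mu>" "\<mu> \<le> 1" "0 < t_e" "t_e < 1"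
    and "t_d = 1 - t_e" "l_o = \<mu> * l" "l_c = (1 - \<mu>) * l"
    and "\<And>\<omega>. \<epsilon> \<omega> = harvested_energy \<gamma>2 \<gamma>4 P r \<alpha> t_e (h \<omega>)"
    and "\<And>\<omega>. \<epsilon>_o \<omega> = offload_energy B \<sigma> r \<alpha> t_d l_o (g \<omega>)"
    and "\<epsilon>_c = local_energy \<xi> \<psi> l_c"
    and "\<phi>_o = (2 powr (l_o / (t_d * B)) - 1) * t_d * \<sigma> ^ 2 * r powr \<alpha>"
    and "\<phi>_c = l_c ^ 3 * \<xi> * \<psi> ^ 3"
  shows "\<P>(\<omega> in M. \<epsilon> \<omega> > \<epsilon>_o \<omega> + \<epsilon>_c) =
    (LINT x:{0<..}|lborel.
       exp (r powr \<alpha> * \<gamma>2 / (3 * \<gamma>4 * P)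
            * (1 - sqrt (1 + 6 * \<gamma>4 / (t_e * \<gamma>2 ^ 2) * (\<phi>_o / x + \<phi>_c))))
       * exp (- x))"
proof -
  interpret prob_space M by fact
  note pos = \<open>P > 0\<close> \<open>r > 0\<close> \<open>\<gamma>2 > 0\<close> \<open>\<gamma>4 > 0\<close> \<open>0 < t_e\<close>
  define K where "K = r powr \<alpha> * \<gamma>2 / (3 * \<gamma>4 * P)"
  \<comment> \<open>\<open>T x\<close> is the level that |h|^2 must exceed when |g|^2 = x; its
    negative is the exponent in the formula.\<close>
  define T where "T x = K * (sqrt (1 + 6 * \<gamma>4 / (t_e * \<gamma>2 ^ 2) * (\<phi>_o / x + \<phi>_c)) - 1)" for x
  let ?X = "\<lambda>\<omega>. (cmod (h \<omega>))\<^sup>2" and ?Y = "\<lambda>\<omega>. (cmod (g \<omega>))\<^sup>2"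
  have X: "distributed M lborel ?X (exponential_density 1)"
    and Y: "distributed M lborel ?Y (exponential_density 1)"
    using assms(2,3) by (auto intro: circ_sym_complex_gaussian_cmod2_exponential)
  have "indep_var borel ((\<lambda>z. (cmod z)\<^sup>2) \<circ> h) borel ((\<lambda>z. (cmod z)\<^sup>2) \<circ> g)"
    by (rule indep_var_compose[OF assms(4)]) simp_all
  then have indep: "indep_var borel ?X borel ?Y"
    by (simp add: o_def)
  have K: "0 \<le> K"
    using pos by (simp add: K_def)
  \<comment> \<open>The power of 2 has a nonnegative exponent, so it is at least 1, and \<mu> \<le>
    1 makes \<open>l_c\<close> nonnegative.\<close>
  have \<phi>_o: "0 \<le> \<phi>_o" and \<phi>_c: "0 \<le> \<phi>_c"
    using assms by (auto intro!: mult_nonneg_nonneg ge_one_powr_ge_zero)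
  have T_nonneg: "0 \<le> T x" if "0 \<le> x" for x
    using that K \<phi>_o \<phi>_c pos by (simp add: T_def)

  text \<open>Holds even where \<open>g \<omega> = 0\<close>: both sides then read their quotient as \<open>x / 0 = 0\<close>.\<close>
  have success_iff: "\<epsilon>_o \<omega> + \<epsilon>_c < \<epsilon> \<omega> \<longleftrightarrow> T (?Y \<omega>) < ?X \<omega>" for \<omega>
  proof -
    \<comment> \<open>\<open>c\<close> is the mean received power, and \<open>q\<close> the required
      energy per unit of harvesting time; the harvested energy becomes a quadratic in |h|^2.\<close>
    define c where "c = P * r powr (- \<alpha>)"
    define q where "q = (\<phi>_o / ?Y \<omega> + \<phi>_c) / t_e"
    have c: "0 < c"
      using pos by (simp add: c_def)
    have q: "0 \<le> q"
      using \<phi>_o \<phi>_c pos by (simp add: q_def)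
    have "r powr (- 2 * \<alpha>) = (r powr (- \<alpha>))\<^sup>2"
      by (simp add: power2_eq_square powr_add[symmetric])
    then have "\<epsilon> \<omega> = t_e * (\<gamma>2 * c * ?X \<omega> + 3 / 2 * \<gamma>4 * c\<^sup>2 * (?X \<omega>)\<^sup>2)"
      by (simp add: assms harvested_energy_def c_def power_mult_distrib power_mult[symmetric])
    moreover have "\<epsilon>_o \<omega> + \<epsilon>_c = t_e * q"
      proof -
      have "t_e * q = \<phi>_o / ?Y \<omega> + \<phi>_c"
        using pos by (simp add: q_def)
      then show ?thesis
        by (simp add: assms offload_energy_def local_energy_def)
    qed
    ultimately have "\<epsilon>_o \<omega> + \<epsilon>_c < \<epsilon> \<omega>
        \<longleftrightarrow> q < \<gamma>2 * c * ?X \<omega> + 3 / 2 * \<gamma>4 * c\<^sup>2 * (?X \<omega>)\<^sup>2"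
      using pos by simp
    also have "\<dots> \<longleftrightarrow> \<gamma>2 * c / (2 * (3 / 2 * \<gamma>4 * c\<^sup>2))
        * (sqrt (1 + 4 * (3 / 2 * \<gamma>4 * c\<^sup>2) * q / (\<gamma>2 * c)\<^sup>2) - 1) < ?X \<omega>"
      using pos c q by (intro quadratic_gt_iff) auto
    \<comment> \<open>One factor \<open>c\<close> survives in the denominator, and 1/c =
      \<open>r powr \<alpha> / P\<close>; under the root, \<open>c\<close> cancels entirely.\<close>
    also have "\<gamma>2 * c / (2 * (3 / 2 * \<gamma>4 * c\<^sup>2)) = K"
      using pos by (simp add: K_def c_def powr_minus field_simps power2_eq_square)
    also have "4 * (3 / 2 * \<gamma>4 * c\<^sup>2) * q / (\<gamma>2 * c)\<^sup>2
        = 6 * \<gamma>4 / (t_e * \<gamma>2 ^ 2) * (\<phi>_o / ?Y \<omega> + \<phi>_c)"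
      using c by (simp add: q_def power_mult_distrib)
    finally show ?thesis
      by (simp add: T_def)
  qed
  have [measurable]: "T \<in> borel_measurable borel"
    unfolding T_def by measurable
  have "\<P>(\<omega> in M. \<epsilon>_o \<omega> + \<epsilon>_c < \<epsilon> \<omega>) = (LINT x|lborel. exponential_density 1 x * exp (- T x))"
    unfolding success_iff
    by (rule prob_exponential_exceeds_indep[OF X Y indep])
       (auto simp: exponential_density_def T_nonneg)
  \<comment> \<open>The exponential density vanishes for negative x and equals 1 at 0; dropping the
    null point 0 leaves the open half-line.\<close>
  also have "\<dots> = (LINT x:{0<..}|lborel. exp (- T x) * exp (- x))"
    unfolding set_lebesgue_integral_def
    using AE_lborel_singleton[of "0 :: real"]
    by (intro integral_cong_AE)
       (auto elim!: eventually_mono split: split_indicator simp: exponential_density_def)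
  also have "(\<lambda>x. - T x) = (\<lambda>x. K * (1 - sqrt (1 + 6 * \<gamma>4 / (t_e * \<gamma>2 ^ 2) * (\<phi>_o / x + \<phi>_c))))"
    by (simp add: T_def fun_eq_iff right_diff_distrib)
  finally show ?thesis
    by (simp add: K_def)
qed

end
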